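(* Let $S$ be a subset of $\omega_1$ such that $\overline{S} \setminus S$ is unbounded in $\omega_1$ and $S$ contains a cub set. Then $\mathcal{K}(S) =_T \Sigma(\omega^{\omega_1})$.
   Context: All posets are directed. For posets $P,Q$, $P \ge_T Q$ means that there is a map $\phi: P \to Q$ taking every cofinal subset of $P$ to a cofinal subset of $Q$; $P =_T Q$ means $P \ge_T Q$ and $Q \ge_T P$. For a space $X$, $\mathcal{K}(X)$ is the set of all compact subsets of $X$ ordered by inclusion. $\Sigma(\omega^{\omega_1})$ is the set of all functions $\omega_1 \to \omega$ that are eventually constantly equal to $0$, ordered pointwise. $\omega_1$ has the order topology, $S$ has the subspace topology, and $\overline{S}$ is the closure of $S$ in $\omega_1$. A cub set is a closed and unbounded subset of $\omega_1$. *)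

theory Defs
  imports "HOL-Analysis.Analysis" "HOL-Library.Countable_Set_Type"
begin

section \<open>The space of countable ordinals\<close>

typedef omega1 = "Field (cardSuc natLeq)"
proof -
  have "infinite (Field (cardSuc natLeq))"
    using cardSuc_finite[OF natLeq_Card_order] by (simp add: Field_natLeq)
  then show ?thesis
    by (metis ex_in_conv finite.emptyI)
qed

lemma Well_order_cardSuc_natLeq: "Well_order (cardSuc natLeq)"
  using cardSuc_Card_order[OF natLeq_Card_order] by (simp add: card_order_on_def)

instantiation omega1 :: linorder
begin

definition less_eq_omega1 :: "omega1 \<Rightarrow> omega1 \<Rightarrow> bool"
  where "x \<le> y \<longleftrightarrow> (Rep_omega1 x, Rep_omega1 y) \<in> cardSuc natLeq"

definition less_omega1 :: "omega1 \<Rightarrow> omega1 \<Rightarrow> bool"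
  where "x < y \<longleftrightarrow> x \<le> y \<and> \<not> y \<le> x" for x y :: omega1

instance
proof -
  have r: "refl_on (Field (cardSuc natLeq)) (cardSuc natLeq)" "trans (cardSuc natLeq)"
    "antisym (cardSuc natLeq)" "total_on (Field (cardSuc natLeq)) (cardSuc natLeq)"
    using Well_order_cardSuc_natLeq by (simp_all add: order_on_defs)
  show "OFCLASS(omega1, linorder_class)"
  proof
    fix x y z :: omega1
    show "x < y \<longleftrightarrow> x \<le> y \<and> \<not> y \<le> x"
      by (rule less_omega1_def)
    show refl: "x \<le> x"
      using r(1) Rep_omega1[of x] by (auto simp: less_eq_omega1_def refl_on_def)
    show "x \<le> z" if "x \<le> y" "y \<le> z"
      using that r(2) by (auto simp: less_eq_omega1_def dest: transD)
    show "x = y" if "x \<le> y" "y \<le> x"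
      using that r(3) by (auto simp: less_eq_omega1_def Rep_omega1_inject dest: antisymD)
    show "x \<le> y \<or> y \<le> x"
      using r(4) Rep_omega1[of x] Rep_omega1[of y] refl
      by (cases "x = y") (auto simp: less_eq_omega1_def total_on_def Rep_omega1_inject)
  qed
qed

end

instance omega1 :: wellorder
proof
  fix P :: "omega1 \<Rightarrow> bool" and a :: omega1
  assume step: "\<And>x. (\<And>y. y < x \<Longrightarrow> P y) \<Longrightarrow> P x"
  have "wf (inv_image (cardSuc natLeq - Id) Rep_omega1)"
    using Well_order_cardSuc_natLeq by (auto simp: well_order_on_def)
  then show "P a"
  proof (induction a rule: wf_induct_rule)
    case (less x)
    show ?case
    proof (rule step)
      fix y :: omega1
      assume "y < x"
      then have "(y, x) \<in> inv_image (cardSuc natLeq - Id) Rep_omega1"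
        by (auto simp: less_le less_eq_omega1_def Rep_omega1_inject)
      then show "P y"
        by (rule less)
    qed
  qed
qed

instantiation omega1 :: linorder_topology
begin

definition open_omega1 :: "omega1 set \<Rightarrow> bool"
  where "open_omega1 = generate_topology (range (\<lambda>a. {..<a}) \<union> range (\<lambda>a. {a<..}))"

instance
  by standard (rule open_omega1_def)

end

text \<open>These two facts determine the wellorder up to isomorphism.\<close>

lemma uncountable_omega1:
  includes cardinal_syntax
  shows "uncountable (UNIV :: omega1 set)"
proof
  assume "countable (UNIV :: omega1 set)"
  then have "countable (Field (cardSuc natLeq))"
    by (metis countable_image type_definition.Rep_range type_definition_omega1)
  then have "|Field (cardSuc natLeq)| \<le>o natLeq"
    by (simp add: countable_card_le_natLeq)
  moreover have "|Field (cardSuc natLeq)| =o cardSuc natLeq"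
    by (rule card_of_Field_ordIso[OF cardSuc_Card_order[OF natLeq_Card_order]])
  ultimately have "cardSuc natLeq \<le>o natLeq"
    using ordIso_ordLeq_trans ordIso_symmetric by blast
  then show False
    using cardSuc_greater[OF natLeq_Card_order] not_ordLess_ordLeq by blast
qed

lemma countable_lessThan_omega1:
  includes cardinal_syntax
  shows "countable {..<a :: omega1}"
proof -
  have "|underS (cardSuc natLeq) (Rep_omega1 a)| <o cardSuc natLeq"
    by (rule card_of_underS[OF cardSuc_Card_order[OF natLeq_Card_order] Rep_omega1])
  then have "countable (underS (cardSuc natLeq) (Rep_omega1 a))"
    using cardSuc_ordLeq_ordLess[OF natLeq_Card_order card_of_Card_order]
    unfolding countable_card_le_natLeq by blast
  moreover have "Rep_omega1 ` {..<a} \<subseteq> underS (cardSuc natLeq) (Rep_omega1 a)"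
    by (auto simp: underS_def less_le less_eq_omega1_def Rep_omega1_inject)
  ultimately have "countable (Rep_omega1 ` {..<a})"
    using countable_subset by blast
  then show ?thesis
    by (rule countable_image_inj_on) (simp add: inj_on_def Rep_omega1_inject)
qed

definition cub :: "omega1 set \<Rightarrow> bool"
  where "cub C \<longleftrightarrow> closed C \<and> \<not> bdd_above C"


section \<open>Tukey order\<close>

text \<open>A poset is a subset of a type of class \<^class>\<open>order\<close> with the induced order.\<close>

definition directed_in :: "'a::order set \<Rightarrow> bool"
  where "directed_in P \<longleftrightarrow> P \<noteq> {} \<and> (\<forall>x\<in>P. \<forall>y\<in>P. \<exists>z\<in>P. x \<le> z \<and> y \<le> z)"

definition cofinal_in :: "'a::order set \<Rightarrow> 'a set \<Rightarrow> bool"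
  where "cofinal_in P C \<longleftrightarrow> C \<subseteq> P \<and> (\<forall>p\<in>P. \<exists>c\<in>C. p \<le> c)"

definition tukey_ge :: "'a::order set \<Rightarrow> 'b::order set \<Rightarrow> bool"  (infix "\<ge>\<^sub>T" 50)
  where "P \<ge>\<^sub>T Q \<longleftrightarrow> (\<exists>\<phi>\<in>P \<rightarrow> Q. \<forall>C. cofinal_in P C \<longrightarrow> cofinal_in Q (\<phi> ` C))"

definition tukey_eq :: "'a::order set \<Rightarrow> 'b::order set \<Rightarrow> bool"  (infix "=\<^sub>T" 50)
  where "P =\<^sub>T Q \<longleftrightarrow> P \<ge>\<^sub>T Q \<and> Q \<ge>\<^sub>T P"


section \<open>The two posets\<close>

definition compact_sets :: "'a topology \<Rightarrow> 'a set set"  ("\<K>")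
  where "\<K> X = {K. compactin X K}"

definition Sigma_omega1 :: "(omega1 \<Rightarrow> nat) set"
  where "Sigma_omega1 = {f. \<forall>\<^sub>F \<alpha> in at_top. f \<alpha> = 0}"

lemma directed_compact_sets: "directed_in (\<K> X)"
proof -
  have "\<exists>M\<in>\<K> X. K \<subseteq> M \<and> L \<subseteq> M" if "K \<in> \<K> X" "L \<in> \<K> X" for K L
    using that by (intro bexI[of _ "K \<union> L"]) (auto simp: compact_sets_def compactin_Un)
  moreover have "{} \<in> \<K> X"
    by (simp add: compact_sets_def)
  ultimately show ?thesis
    unfolding directed_in_def by blast
qed

lemma directed_Sigma_omega1: "directed_in Sigma_omega1"
proof -
  have "\<exists>h\<in>Sigma_omega1. f \<le> h \<and> g \<le> h" if "f \<in> Sigma_omega1" "g \<in> Sigma_omega1" for f g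
    using that
    by (intro bexI[of _ "\<lambda>\<alpha>. max (f \<alpha>) (g \<alpha>)"])
      (auto simp: Sigma_omega1_def le_fun_def elim: eventually_elim2)
  moreover have "(\<lambda>_. 0) \<in> Sigma_omega1"
    by (simp add: Sigma_omega1_def)
  ultimately show ?thesis
    unfolding directed_in_def by blast
qed

end

theory Submission
  imports Defs
begin

text \<open>Let \<open>C\<close> be a cub set contained in \<open>S\<close>. Every \<open>x \<notin> C\<close> has a decreasing countable
  neighbourhood base \<open>V x 0 \<supseteq> V x 1 \<supseteq> \<dots>\<close> of intervals ending at \<open>x\<close> and missing \<open>C\<close>. A subset of
  \<open>S\<close> is compact iff it is bounded and misses a neighbourhood of every \<open>x \<notin> S\<close>, so \<open>f \<in> \<Sigma>\<close> codes
  the compact set of all points below some element of \<open>C\<close> beyond the support of \<open>f\<close> that lie in no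
  \<open>V x (f x)\<close> with \<open>x \<notin> S\<close>. This is monotone in \<open>f\<close>, because for \<open>x > c \<in> C\<close> the set \<open>V x n\<close> lies
  above \<open>c\<close>, and it is cofinal.

  Conversely, choose \<open>x\<^sub>\<alpha> \<in> closure S - S\<close> for \<open>\<alpha> < \<omega>\<^sub>1\<close> such that any two of them are separated
  by a point of \<open>C\<close>, and send a compact \<open>K\<close> to the function whose value at \<open>\<alpha>\<close> is the least \<open>n\<close> such
  that \<open>K\<close> misses \<open>V x\<^sub>\<alpha> n\<close>. To dominate \<open>g\<close>, take one point of \<open>S\<close> in each \<open>V x\<^sub>\<alpha> (g \<alpha>)\<close> for
  countably many \<open>\<alpha>\<close>. The limit points of the set so obtained are in \<open>C\<close>, hence adding an initial
  segment of \<open>C\<close> makes it compact.\<close>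

section \<open>Tukey reductions given by monotone maps\<close>

text \<open>If \<open>q \<le> \<phi> p\<close>, a cofinal set has a member above \<open>p\<close>,
  and by monotonicity its image is above \<open>q\<close>. Both reductions below have this
  form.\<close>

lemma tukey_geI:
  assumes "\<And>p. p \<in> P \<Longrightarrow> \<phi> p \<in> Q"
    and mono: "\<And>p p'. p \<in> P \<Longrightarrow> p' \<in> P \<Longrightarrow> p \<le> p' \<Longrightarrow> \<phi> p \<le> \<phi> p'"
    and dom: "\<And>q. q \<in> Q \<Longrightarrow> \<exists>p\<in>P. q \<le> \<phi> p"
  shows "P \<ge>\<^sub>T Q"
  unfolding tukey_ge_def
proof (intro bexI[of _ \<phi>] allI impI)
  show "\<phi> \<in> P \<rightarrow> Q"
    using assms(1) by blast
next
  fix A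
  assume A: "cofinal_in P A"
  then have "A \<subseteq> P"
    by (simp add: cofinal_in_def)
  have "\<exists>c\<in>A. q \<le> \<phi> c" if q: "q \<in> Q" for q
  proof -
    obtain p where "p \<in> P" "q \<le> \<phi> p"
      using dom[OF q] by blast
    moreover from A \<open>p \<in> P\<close> obtain c where "c \<in> A" "p \<le> c"
      by (auto simp: cofinal_in_def)
    ultimately show ?thesis
      using mono \<open>A \<subseteq> P\<close> by (meson order_trans subsetD)
  qed
  with assms(1) \<open>A \<subseteq> P\<close> show "cofinal_in Q (\<phi> ` A)"
    by (auto simp: cofinal_in_def)
qed

section \<open>Boundedness and compactness in the space of countable ordinals\<close>

text \<open>Otherwise countably many countable initial segments would cover an uncountable
  space.\<close>

lemma countable_bdd_above_omega1:
  fixes A :: "omega1 set"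
  assumes "countable A"
  shows "bdd_above A"
proof (rule ccontr)
  assume "\<not> bdd_above A"
  then have "UNIV = (\<Union>a\<in>A. {..<a})"
    by (auto simp: bdd_above_def not_le)
  then show False
    using assms countable_lessThan_omega1 uncountable_omega1 by (metis countable_UN)
qed

lemma unbounded_gt:
  fixes A :: "'a::linorder set"
  assumes "\<not> bdd_above A"
  obtains a where "a \<in> A" "x < a"
  using assms by (meson bdd_above.I not_le)

lemma omega1_gt_ex: "\<exists>y. x < (y :: omega1)"
proof (rule ccontr)
  assume "\<nexists>y. x < y"
  then have "UNIV = insert x {..<x}"
    by (auto simp: not_less intro: antisym)
  then show False
    using countable_lessThan_omega1 uncountable_omega1 by (metis countable_insert)
qed

text \<open>The segment is the open ray below the immediate successor of \<open>x\<close>. Hence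
  neighbourhoods of \<open>x\<close> can be taken inside \<open>{..x}\<close>.\<close>

lemma open_atMost_omega1: "open {..x :: omega1}"
proof -
  obtain y where y: "x < y" "\<And>z. x < z \<Longrightarrow> y \<le> z"
    by (metis omega1_gt_ex LeastI Least_le)
  then have "{..x} = {..<y}"
    by (auto simp: not_less) (meson leD leI)
  then show ?thesis
    by simp
qed

text \<open>By induction on \<open>b\<close>: a member of the cover containing \<open>b\<close>
  swallows some \<open>{a<..b}\<close>, and finitely many members suffice for
  \<open>{..a}\<close>.\<close>

lemma compact_atMost_omega1: "compact {..b :: omega1}"
proof (induction b rule: less_induct)
  case (less b)
  show ?case
  proof (rule compactI)
    fix F :: "omega1 set set"
    assume F: "\<forall>W\<in>F. open W" "{..b} \<subseteq> \<Union>F"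
    then obtain W where W: "W \<in> F" "b \<in> W" "open W"
      by blast
    show "\<exists>F'\<subseteq>F. finite F' \<and> {..b} \<subseteq> \<Union>F'"
    proof (cases "\<exists>a. a < b")
      case True
      then obtain a where a: "a < b" "{a<..b} \<subseteq> W"
        using open_left[OF W(3,2)] by blast
      obtain F' where F': "F' \<subseteq> F" "finite F'" "{..a} \<subseteq> \<Union>F'"
        using less[OF a(1)] F a(1) unfolding compact_eq_Heine_Borel
        by (metis atMost_subset_iff less_imp_le order_trans)
      have "{..b} \<subseteq> {..a} \<union> {a<..b}"
        by auto
      then have "{..b} \<subseteq> \<Union>(insert W F')"
        using F'(3) a(2) by blast
      then show ?thesis
        using F' W(1) by (intro exI[of _ "insert W F'"]) auto
    next
      case False
      then have "{..b} = {b}"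
        by (auto simp: le_less)
      then show ?thesis
        using W by (intro exI[of _ "{W}"]) auto
    qed
  qed
qed

lemma compact_omega1_iff: "compact K \<longleftrightarrow> closed K \<and> bdd_above (K :: omega1 set)"
proof
  assume K: "compact K"
  have "K \<subseteq> (\<Union>a\<in>UNIV. {..<a})"
    using omega1_gt_ex by auto
  then obtain A where A: "finite A" "K \<subseteq> (\<Union>a\<in>A. {..<a})"
    using compactE_image[OF K, of UNIV "\<lambda>a. {..<a}"] by (metis open_lessThan)
  obtain b where "\<And>a. a \<in> A \<Longrightarrow> a \<le> b"
    using countable_bdd_above_omega1[OF countable_finite[OF A(1)]] by (auto simp: bdd_above_def)
  then have "(\<Union>a\<in>A. {..<a}) \<subseteq> {..b}"
    by fastforce
  then have "K \<subseteq> {..b}"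
    using A(2) by blast
  then show "closed K \<and> bdd_above K"
    using compact_imp_closed[OF K] by (auto simp: bdd_above_def)
next
  assume K: "closed K \<and> bdd_above K"
  then obtain b where "K \<subseteq> {..b}"
    by (auto simp: bdd_above_def)
  then have "K = {..b} \<inter> K"
    by blast
  then show "compact K"
    using K compact_Int_closed[OF compact_atMost_omega1] by metis
qed

lemma mem_compact_sets_omega1:
  "K \<in> \<K> (top_of_set S) \<longleftrightarrow> K \<subseteq> S \<and> closed K \<and> bdd_above (K :: omega1 set)"
  by (auto simp: compact_sets_def compactin_subtopology compact_omega1_iff)

section \<open>Decreasing countable bases of left neighbourhoods\<close>

lemma nested_nbhd_base_omega1:
  fixes x :: omega1
  shows "\<exists>U :: nat \<Rightarrow> omega1 set.
    (\<forall>n. open (U n) \<and> x \<in> U n \<and> U n \<subseteq> {..x} \<and> (\<forall>a b. a \<in> U n \<longrightarrow> a \<le> b \<longrightarrow> b \<le> x \<longrightarrow> b \<in> U n))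
    \<and> antimono U \<and> (\<forall>W. open W \<longrightarrow> x \<in> W \<longrightarrow> (\<exists>n. U n \<subseteq> W))"
proof (cases "\<exists>a. a < x")
  case False
  then have "{..x} = {x}"
    by (auto simp: le_less)
  moreover from this have "open {x}"
    using open_atMost_omega1 by metis
  ultimately show ?thesis
    using False by (intro exI[of _ "\<lambda>_. {x}"]) (auto simp: monotone_on_def le_less)
next
  case True
  \<comment> \<open>The sequence \<open>e\<close> lists the countably many points below
    \<open>x\<close>, possibly with repetitions. It needs at least one such point, so the least
    ordinal is treated separately.\<close>
  define e where "e = from_nat_into {..<x}"
  have e_range: "range e = {..<x}"
    unfolding e_def using True countable_lessThan_omega1 by (intro range_from_nat_into) auto
  then have e_less: "e i < x" for i
    by blast
  define U where "U n = {..x} \<inter> (\<Inter>i\<in>{..n}. {e i<..})" for n :: nat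
  have "open (U n)" for n
    unfolding U_def by (intro open_Int open_atMost_omega1 open_INT) auto
  moreover have "\<exists>n. U n \<subseteq> W" if W: "open W" "x \<in> W" for W
  proof -
    obtain a where "a < x" "{a<..x} \<subseteq> W"
      using open_left[OF W] True by blast
    moreover then obtain n where "e n = a"
      using e_range by (metis lessThan_iff rangeE)
    ultimately have "U n \<subseteq> W"
      by (auto simp: U_def)
    then show ?thesis ..
  qed
  ultimately show ?thesis
    by (intro exI[of _ U]) (auto simp: U_def monotone_on_def e_less intro: less_le_trans)
qed

text \<open>By the convexity clause, a point of \<open>C\<close> below \<open>x\<close> is a strict
  lower bound of every \<open>V x n\<close>. This is how \<open>C\<close> separates neighbourhoods
  in both reductions.\<close>

lemma nested_nbhd_base_avoiding:
  fixes C :: "omega1 set"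
  assumes "closed C"
  obtains V :: "omega1 \<Rightarrow> nat \<Rightarrow> omega1 set"
  where "\<And>x n. x \<notin> C \<Longrightarrow> open (V x n)"
    and "\<And>x n. x \<notin> C \<Longrightarrow> x \<in> V x n"
    and "\<And>x n. x \<notin> C \<Longrightarrow> V x n \<subseteq> {..x}"
    and "\<And>x n a b. x \<notin> C \<Longrightarrow> a \<in> V x n \<Longrightarrow> a \<le> b \<Longrightarrow> b \<le> x \<Longrightarrow> b \<notin> C \<and> b \<in> V x n"
    and "\<And>x. x \<notin> C \<Longrightarrow> antimono (V x)"
    and "\<And>x W. x \<notin> C \<Longrightarrow> open W \<Longrightarrow> x \<in> W \<Longrightarrow> \<exists>n. V x n \<subseteq> W"
proof -
  obtain U :: "omega1 \<Rightarrow> nat \<Rightarrow> omega1 set" where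
    U1: "\<And>x n. open (U x n)" "\<And>x n. x \<in> U x n" "\<And>x n. U x n \<subseteq> {..x}"
    and U2: "\<And>x n a b. a \<in> U x n \<Longrightarrow> a \<le> b \<Longrightarrow> b \<le> x \<Longrightarrow> b \<in> U x n"
    and U3: "\<And>x. antimono (U x)"
    and U4: "\<And>x W. open W \<Longrightarrow> x \<in> W \<Longrightarrow> \<exists>n. U x n \<subseteq> W"
    using nested_nbhd_base_omega1 by metis
  have "\<exists>N. \<forall>x. x \<notin> C \<longrightarrow> U x (N x) \<subseteq> - C"
    using U4[of "- C"] assms by (intro choice) auto
  then obtain N where N: "\<And>x. x \<notin> C \<Longrightarrow> U x (N x) \<subseteq> - C"
    by blast
  \<comment> \<open>From index \<open>N x\<close> on the base misses \<open>C\<close>, so its first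
    \<open>N x\<close> members are dropped.\<close>
  define V where "V x n = U x (N x + n)" for x n
  have sub: "V x n \<subseteq> U x (N x)" "V x n \<subseteq> U x n" for x n
    unfolding V_def using U3 by (simp_all add: antimonoD)
  show thesis
  proof (rule that[of V])
    show "open (V x n)" "x \<in> V x n" "V x n \<subseteq> {..x}" for x n
      using U1 by (simp_all add: V_def)
    show "b \<notin> C \<and> b \<in> V x n" if "x \<notin> C" "a \<in> V x n" "a \<le> b" "b \<le> x" for x n a b
    proof -
      have "b \<in> V x n"
        using U2 that by (simp add: V_def)
      then show ?thesis
        using N[OF that(1)] sub(1) by blast
    qed
    show "antimono (V x)" for x
      using U3[of x] by (simp add: V_def monotone_on_def)
    show "\<exists>n. V x n \<subseteq> W" if "open W" "x \<in> W" for x W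
      using U4[OF that] sub(2) by blast
  qed
qed

lemma Sigma_omega1_iff: "f \<in> Sigma_omega1 \<longleftrightarrow> (\<exists>b. \<forall>a\<ge>b. f a = 0)"
  by (simp add: Sigma_omega1_def eventually_at_top_linorder)

section \<open>The reduction from functions to compact sets\<close>

lemma Sigma_omega1_tukey_ge_compact_sets:
  assumes "C \<subseteq> S" "cub C"
  shows "Sigma_omega1 \<ge>\<^sub>T \<K> (top_of_set S)"
proof -
  have C: "closed C" "\<not> bdd_above C"
    using assms(2) by (auto simp: cub_def)
  obtain V :: "omega1 \<Rightarrow> nat \<Rightarrow> omega1 set"
    where V_open: "\<And>x n. x \<notin> C \<Longrightarrow> open (V x n)"
      and V_mem: "\<And>x n. x \<notin> C \<Longrightarrow> x \<in> V x n"
      and V_convex: "\<And>x n a b. x \<notin> C \<Longrightarrow> a \<in> V x n \<Longrightarrow> a \<le> b \<Longrightarrow> b \<le> x \<Longrightarrow> b \<notin> C \<and> b \<in> V x n"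
      and V_anti: "\<And>x. x \<notin> C \<Longrightarrow> antimono (V x)"
      and V_base: "\<And>x W. x \<notin> C \<Longrightarrow> open W \<Longrightarrow> x \<in> W \<Longrightarrow> \<exists>n. V x n \<subseteq> W"
    by (rule nested_nbhd_base_avoiding[OF C(1)]) (rule that)
  have V_above: "y \<notin> V x n" if "x \<notin> S" "c \<in> C" "c < x" "y \<le> c" for x y c n
    using V_convex[of x y n c] that assms(1) by (meson less_imp_le subsetD)
  \<comment> \<open>Taking the least such point of \<open>C\<close> makes \<open>b\<close> monotone:
    a bound that works for \<open>g\<close> works for every \<open>f \<le> g\<close>.\<close>
  define b where "b f = (LEAST b. b \<in> C \<and> (\<forall>a\<ge>b. f a = 0))" for f :: "omega1 \<Rightarrow> nat"
  have b: "b f \<in> C" "\<And>a. b f \<le> a \<Longrightarrow> f a = 0" if f: "f \<in> Sigma_omega1" for f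
  proof -
    obtain z where z: "\<And>a. z \<le> a \<Longrightarrow> f a = 0"
      using f by (auto simp: Sigma_omega1_iff)
    obtain c where "c \<in> C" "z < c"
      using unbounded_gt[OF C(2)] by blast
    with z have "c \<in> C \<and> (\<forall>a\<ge>c. f a = 0)"
      by (auto intro: order_trans less_imp_le)
    from LeastI[of "\<lambda>b. b \<in> C \<and> (\<forall>a\<ge>b. f a = 0)", OF this]
    show "b f \<in> C" "\<And>a. b f \<le> a \<Longrightarrow> f a = 0"
      unfolding b_def by auto
  qed
  define \<phi> where "\<phi> f = {..b f} - (\<Union>x\<in>-S. V x (f x))" for f
  show ?thesis
  proof (rule tukey_geI[where \<phi> = \<phi>])
    fix f assume "f \<in> Sigma_omega1"
    have "open (\<Union>x\<in>-S. V x (f x))"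
      using V_open assms(1) by blast
    then have "closed (\<phi> f)"
      unfolding \<phi>_def by (intro closed_Diff closed_atMost)
    moreover have "\<phi> f \<subseteq> S"
      using V_mem assms(1) by (auto simp: \<phi>_def)
    moreover have "bdd_above (\<phi> f)"
      by (rule bdd_aboveI[of _ "b f"]) (simp add: \<phi>_def)
    ultimately show "\<phi> f \<in> \<K> (top_of_set S)"
      by (simp add: mem_compact_sets_omega1)
  next
    fix f g assume f: "f \<in> Sigma_omega1" and g: "g \<in> Sigma_omega1" and "f \<le> g"
    have "f a = 0" if "b g \<le> a" for a
      using b(2)[OF g that] \<open>f \<le> g\<close> by (metis le_fun_def le_zero_eq)
    then have bfg: "b f \<le> b g"
      using b(1)[OF g] unfolding b_def[of f] by (intro Least_le) auto
    show "\<phi> f \<le> \<phi> g"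
    proof
      fix y assume y: "y \<in> \<phi> f"
      have "y \<notin> V x (g x)" if "x \<notin> S" for x
      proof -
        have "V x (g x) \<subseteq> V x (f x)"
          using V_anti[of x] that assms(1) \<open>f \<le> g\<close> by (auto simp: le_fun_def monotone_on_def)
        then show ?thesis
          using y that by (auto simp: \<phi>_def)
      qed
      then show "y \<in> \<phi> g"
        using y bfg by (auto simp: \<phi>_def)
    qed
  next
    fix K assume "K \<in> \<K> (top_of_set S)"
    then have K: "K \<subseteq> S" "closed K" "bdd_above K"
      by (auto simp: mem_compact_sets_omega1)
    have "\<exists>h. \<forall>x. x \<notin> S \<longrightarrow> V x (h x) \<subseteq> - K"
      using V_base[of _ "- K"] K(1,2) assms(1) by (intro choice) (auto simp: subset_iff)
    then obtain h where h: "\<And>x. x \<notin> S \<Longrightarrow> V x (h x) \<subseteq> - K"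
      by blast
    obtain k where "\<And>y. y \<in> K \<Longrightarrow> y \<le> k"
      using K(3) by (auto simp: bdd_above_def)
    moreover obtain c where c: "c \<in> C" "k < c"
      using unbounded_gt[OF C(2)] by blast
    ultimately have Kc: "\<And>y. y \<in> K \<Longrightarrow> y \<le> c"
      by (meson less_imp_le order_trans)
    \<comment> \<open>\<open>Suc\<close> makes \<open>f\<close> nonzero at \<open>c\<close>, even
      where \<open>h\<close> is zero, and this forces \<open>b f\<close> above \<open>c\<close> and
      hence above \<open>K\<close>. The larger index only shrinks the removed neighbourhood.\<close>
    define f where "f x = (if x \<le> c then Suc (h x) else 0)" for x
    obtain d where "c < d"
      using omega1_gt_ex by blast
    then have f: "f \<in> Sigma_omega1"
      unfolding Sigma_omega1_iff f_def by (intro exI[of _ d]) auto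
    have "c < b f"
      using b(2)[OF f, of c] by (auto simp: f_def not_le[symmetric])
    have "y \<notin> V x (f x)" if "x \<notin> S" "y \<in> K" for x y
    proof (cases "x \<le> c")
      case True
      then have "V x (f x) \<subseteq> V x (h x)"
        using antimonoD[OF V_anti[of x], of "h x" "f x"] that(1) assms(1) by (auto simp: f_def)
      then show ?thesis
        using h that by blast
    next
      case False
      then show ?thesis
        using V_above[OF that(1) c(1)] Kc[OF that(2)] by auto
    qed
    moreover have "K \<subseteq> {..b f}"
      using Kc \<open>c < b f\<close> by (meson atMost_iff le_less_trans less_imp_le subsetI)
    ultimately have "K \<subseteq> \<phi> f"
      by (auto simp: \<phi>_def)
    then show "\<exists>p\<in>Sigma_omega1. K \<le> \<phi> p"
      using f by blast
  qed
qed

section \<open>The reduction from compact sets to functions\<close>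

lemma compact_sets_tukey_ge_Sigma_omega1:
  assumes "\<not> bdd_above (closure S - S)" "C \<subseteq> S" "cub C"
  shows "\<K> (top_of_set S) \<ge>\<^sub>T Sigma_omega1"
proof -
  have C: "closed C" "\<not> bdd_above C"
    using assms(3) by (auto simp: cub_def)
  obtain V :: "omega1 \<Rightarrow> nat \<Rightarrow> omega1 set"
    where V_open: "\<And>x n. x \<notin> C \<Longrightarrow> open (V x n)"
      and V_mem: "\<And>x n. x \<notin> C \<Longrightarrow> x \<in> V x n"
      and V_le: "\<And>x n. x \<notin> C \<Longrightarrow> V x n \<subseteq> {..x}"
      and V_convex: "\<And>x n a b. x \<notin> C \<Longrightarrow> a \<in> V x n \<Longrightarrow> a \<le> b \<Longrightarrow> b \<le> x \<Longrightarrow> b \<notin> C \<and> b \<in> V x n"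
      and V_anti: "\<And>x. x \<notin> C \<Longrightarrow> antimono (V x)"
      and V_base: "\<And>x W. x \<notin> C \<Longrightarrow> open W \<Longrightarrow> x \<in> W \<Longrightarrow> \<exists>n. V x n \<subseteq> W"
    using nested_nbhd_base_avoiding[OF C(1)] by blast
  \<comment> \<open>Recursion along the wellorder yields pairs of a separating point in
    \<open>C\<close> and a point of \<open>closure S - S\<close>. The earlier pairs are countably
    many, hence bounded. Requiring \<open>\<alpha> < fst (p \<alpha>)\<close> pushes the pairs
    beyond every bound.\<close>
  have "\<exists>p :: omega1 \<Rightarrow> omega1 \<times> omega1. \<forall>\<alpha>. fst (p \<alpha>) \<in> C \<and> snd (p \<alpha>) \<in> closure S - S
    \<and> \<alpha> < fst (p \<alpha>) \<and> fst (p \<alpha>) < snd (p \<alpha>) \<and> (\<forall>\<beta><\<alpha>. snd (p \<beta>) < fst (p \<alpha>))"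
  proof (rule dependent_wellorder_choice)
    fix \<alpha> and p :: "omega1 \<Rightarrow> omega1 \<times> omega1"
    have "countable (insert \<alpha> ((snd \<circ> p) ` {..<\<alpha>}))"
      using countable_lessThan_omega1 by blast
    then obtain z where z: "\<And>y. y \<in> insert \<alpha> ((snd \<circ> p) ` {..<\<alpha>}) \<Longrightarrow> y \<le> z"
      using countable_bdd_above_omega1 by (meson bdd_above.E)
    obtain c where c: "c \<in> C" "z < c"
      using unbounded_gt[OF C(2)] by blast
    obtain x where x: "x \<in> closure S - S" "c < x"
      using unbounded_gt[OF assms(1)] by blast
    have "\<alpha> < c" "\<forall>\<beta><\<alpha>. snd (p \<beta>) < c"
      using z c(2) by (auto intro: le_less_trans)
    then show "\<exists>r. fst r \<in> C \<and> snd r \<in> closure S - S \<and> \<alpha> < fst r \<and> fst r < snd r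
      \<and> (\<forall>\<beta><\<alpha>. snd (p \<beta>) < fst r)"
      using c x by (intro exI[of _ "(c, x)"]) auto
  qed auto
  then obtain p :: "omega1 \<Rightarrow> omega1 \<times> omega1" where p: "\<And>\<alpha>. fst (p \<alpha>) \<in> C \<and> snd (p \<alpha>) \<in> closure S - S
    \<and> \<alpha> < fst (p \<alpha>) \<and> fst (p \<alpha>) < snd (p \<alpha>) \<and> (\<forall>\<beta><\<alpha>. snd (p \<beta>) < fst (p \<alpha>))"
    by blast
  define c x where "c = fst \<circ> p" and "x = snd \<circ> p"
  have c: "c \<alpha> \<in> C" "\<alpha> < c \<alpha>" "c \<alpha> < x \<alpha>" "\<beta> < \<alpha> \<Longrightarrow> x \<beta> < c \<alpha>"
    and x: "x \<alpha> \<in> closure S" "x \<alpha> \<notin> S" "x \<alpha> \<notin> C" for \<alpha> \<beta>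
    using p[of \<alpha>] assms(2) by (auto simp: c_def x_def)
  have V_above: "c \<alpha> < y" if "y \<in> V (x \<alpha>) n" for \<alpha> y n
  proof (rule ccontr)
    assume "\<not> c \<alpha> < y"
    with V_convex[OF x(3) that, of "c \<alpha>"] c(1,3)[of \<alpha>] show False
      by (meson less_imp_le not_le)
  qed
  have "\<exists>s. \<forall>\<alpha> n. s \<alpha> n \<in> S \<inter> V (x \<alpha>) n"
  proof (intro choice allI)
    fix \<alpha> n
    have "S \<inter> V (x \<alpha>) n \<noteq> {}"
      using x(1)[of \<alpha>] V_open[OF x(3), of \<alpha> n] V_mem[OF x(3), of \<alpha> n]
      unfolding closure_iff_nhds_not_empty by (metis order_refl)
    then show "\<exists>y. y \<in> S \<inter> V (x \<alpha>) n"
      by blast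
  qed
  then obtain s where s: "\<And>\<alpha> n. s \<alpha> n \<in> S" "\<And>\<alpha> n. s \<alpha> n \<in> V (x \<alpha>) n"
    by blast
  have s_bounds: "c \<alpha> < s \<alpha> n" "s \<alpha> n \<le> x \<alpha>" for \<alpha> n
    using V_above[OF s(2)] subsetD[OF V_le[OF x(3)] s(2)] by auto
  have s_less_c: "s \<alpha> n < c \<alpha>'" if "\<alpha> < \<alpha>'" for \<alpha> \<alpha>' n
    using s_bounds(2) c(4)[OF that] by (rule le_less_trans)
  \<comment> \<open>The minimum exists because \<open>x \<alpha>\<close> lies outside the closed set
    \<open>K\<close>. If \<open>\<alpha>\<close> bounds \<open>K\<close>, then all of
    \<open>V (x \<alpha>) 0\<close> lies above \<open>K\<close> and the value is 0.\<close>
  define \<phi> where "\<phi> K = (\<lambda>\<alpha>. LEAST n. V (x \<alpha>) n \<inter> K = {})" for K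
  have ex: "\<exists>n. V (x \<alpha>) n \<inter> K = {}" if "K \<subseteq> S" "closed K" for K \<alpha>
    using V_base[OF x(3), of "- K" \<alpha>] that x(2)[of \<alpha>] by (auto simp: disjoint_eq_subset_Compl)
  have \<phi>: "V (x \<alpha>) (\<phi> K \<alpha>) \<inter> K = {}" if "K \<subseteq> S" "closed K" for K \<alpha>
    unfolding \<phi>_def by (rule LeastI_ex[OF ex[OF that]])
  show ?thesis
  proof (rule tukey_geI[where \<phi> = \<phi>])
    fix K assume "K \<in> \<K> (top_of_set S)"
    then obtain k where k: "\<And>y. y \<in> K \<Longrightarrow> y \<le> k"
      by (auto simp: mem_compact_sets_omega1 bdd_above_def)
    have "\<phi> K \<alpha> = 0" if "k \<le> \<alpha>" for \<alpha>
    proof -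
      have "y \<notin> K" if "y \<in> V (x \<alpha>) 0" for y
        using V_above[OF that] c(2)[of \<alpha>] \<open>k \<le> \<alpha>\<close> k[of y] by auto
      then show ?thesis
        unfolding \<phi>_def by (intro Least_eq_0) blast
    qed
    then show "\<phi> K \<in> Sigma_omega1"
      by (auto simp: Sigma_omega1_iff)
  next
    fix K L assume "K \<in> \<K> (top_of_set S)" "L \<in> \<K> (top_of_set S)" "K \<subseteq> L"
    \<comment> \<open>A neighbourhood missing \<open>L\<close> also misses \<open>K\<close>, so the
      least index for \<open>K\<close> is no larger.\<close>
    then have "V (x \<alpha>) (\<phi> L \<alpha>) \<inter> K = {}" for \<alpha>
      using \<phi>[of L \<alpha>] by (auto simp: mem_compact_sets_omega1)
    then show "\<phi> K \<le> \<phi> L"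
      unfolding le_fun_def \<phi>_def[of K] by (auto intro: Least_le)
  next
    fix g assume "g \<in> Sigma_omega1"
    then obtain \<beta> where \<beta>: "\<And>\<alpha>. \<beta> \<le> \<alpha> \<Longrightarrow> g \<alpha> = 0"
      by (auto simp: Sigma_omega1_iff)
    \<comment> \<open>The chosen points for \<open>\<alpha> < \<beta>\<close> all lie below
      \<open>c \<beta>\<close>; the segment of \<open>C\<close> supplies their possible limit
      points.\<close>
    define K where "K = (\<lambda>\<alpha>. s \<alpha> (g \<alpha>)) ` {..<\<beta>} \<union> (C \<inter> {..c \<beta>})"
    have K_le: "y \<le> c \<beta>" if "y \<in> K" for y
      using that s_less_c[of _ \<beta>] by (auto simp: K_def intro: less_imp_le)
    have "\<exists>W. open W \<and> y \<in> W \<and> W \<subseteq> - K" if "y \<notin> K" for y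
    proof (cases "y \<le> c \<beta>")
      case False
      then show ?thesis
        using K_le by (intro exI[of _ "{c \<beta><..}"]) (auto simp: not_le[symmetric])
    next
      case True
      with that have y: "y \<notin> C"
        by (auto simp: K_def)
      let ?A = "V y 0 \<inter> (\<lambda>\<alpha>. s \<alpha> (g \<alpha>)) ` {..<\<beta>}"
      \<comment> \<open>Two chosen points in \<open>V y 0\<close> would have
        \<open>c \<alpha>'\<close> between them, but this interval misses \<open>C\<close>. So
        \<open>V y 0\<close> contains at most one chosen point, and removing it leaves a
        neighbourhood of \<open>y\<close> disjoint from \<open>K\<close>.\<close>
      have False if "s \<alpha> n \<in> V y 0" "s \<alpha>' n' \<in> V y 0" "\<alpha> < \<alpha>'" for \<alpha> \<alpha>' n n'
      proof -
        have "s \<alpha>' n' \<le> y"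
          using V_le[OF y] that(2) by blast
        then have "s \<alpha> n \<le> c \<alpha>'" "c \<alpha>' \<le> y"
          using s_less_c[OF that(3), of n] s_bounds(1)[of \<alpha>' n'] by auto
        then show False
          using V_convex[OF y that(1)] c(1) by blast
      qed
      then have "\<alpha> = \<alpha>'" if "s \<alpha> (g \<alpha>) \<in> V y 0" "s \<alpha>' (g \<alpha>') \<in> V y 0" for \<alpha> \<alpha>'
        using that by (metis linorder_neqE)
      then have "\<exists>z. ?A \<subseteq> {z}"
        by blast
      then have "closed ?A"
        by (metis finite.emptyI finite.insertI finite_imp_closed finite_subset)
      then have "open (V y 0 - ?A)"
        using V_open[OF y] by (rule open_Diff[rotated])
      moreover have "V y 0 \<inter> C = {}"
        using V_convex[OF y] V_le[OF y] by blast
      ultimately show ?thesis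
        using that V_mem[OF y] by (intro exI[of _ "V y 0 - ?A"]) (auto simp: K_def)
    qed
    then have "open (- K)"
      by (subst open_subopen) auto
    then have "closed K"
      by (simp add: closed_def)
    moreover have "K \<subseteq> S"
      using s(1) assms(2) by (auto simp: K_def)
    moreover have "bdd_above K"
      using K_le by (rule bdd_aboveI)
    ultimately have "K \<in> \<K> (top_of_set S)"
      by (simp add: mem_compact_sets_omega1)
    moreover have "g \<alpha> \<le> \<phi> K \<alpha>" for \<alpha>
    proof (cases "\<alpha> < \<beta>")
      case True
      show ?thesis
      proof (rule ccontr)
        \<comment> \<open>With a smaller index the neighbourhood would be larger and still contain
          the point of \<open>K\<close> chosen in
          \<open>V (x \<alpha>) (g \<alpha>)\<close>.\<close>
        assume "\<not> g \<alpha> \<le> \<phi> K \<alpha>"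
        then have "s \<alpha> (g \<alpha>) \<in> V (x \<alpha>) (\<phi> K \<alpha>)"
          using antimonoD[OF V_anti[OF x(3)], of "\<phi> K \<alpha>" "g \<alpha>" \<alpha>] s(2) by auto
        moreover have "s \<alpha> (g \<alpha>) \<in> K"
          using True by (simp add: K_def)
        ultimately show False
          using \<phi>[OF \<open>K \<subseteq> S\<close> \<open>closed K\<close>] by blast
      qed
    next
      case False
      then show ?thesis
        using \<beta> by simp
    qed
    ultimately show "\<exists>K\<in>\<K> (top_of_set S). g \<le> \<phi> K"
      by (auto simp: le_fun_def)
  qed
qed

theorem proposition23:
  fixes S :: "omega1 set"
  assumes "\<not> bdd_above (closure S - S)"
    and "\<exists>C. C \<subseteq> S \<and> cub C"
  shows "\<K> (top_of_set S) =\<^sub>T Sigma_omega1"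
proof -
  obtain C where "C \<subseteq> S" "cub C"
    using assms(2) by blast
  then show ?thesis
    unfolding tukey_eq_def
    using Sigma_omega1_tukey_ge_compact_sets compact_sets_tukey_ge_Sigma_omega1[OF assms(1)] by simp
qed

end
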